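(* Let $\Omega$ be an $\mathbb R_+$-conic open set in $\mathbb R^n$ and let $V$ be an open neighborhood of $\widehat\Omega$ in $\mathbb D_{\mathbb C^n}$. Then there exists an open set $U$ in $\mathbb D_{\mathbb C^n}$ satisfying the following three conditions: 1. $\widehat\Omega\subset U\subset V$. 2. $U$ is regular at $\infty$. 3. $U\cap\mathbb C^n$ is a Stein open set.
   Context: $n\ge1$. $\mathbb D_{\mathbb C^n}=\mathbb C^n\sqcup S^{2n-1}\infty$ is the radial compactification of $\mathbb C^n$, where $S^{2n-1}$ is the unit sphere of $\mathbb C^n\simeq\mathbb R^{2n}$; similarly $\mathbb D_{\mathbb R^n}=\mathbb R^n\sqcup S^{n-1}\infty\subset\mathbb D_{\mathbb C^n}$. A fundamental system of neighborhoods of $z_0\in\mathbb C^n$ is given by the balls $\{|z-z_0|<\varepsilon\}$, $\varepsilon>0$, and of $\zeta_0\infty\in S^{2n-1}\infty$ by the sets $\{z\in\mathbb C^n:|z|>r,\ z/|z|\in\Gamma\}\cup\Gamma\infty$, $r>0$, $\Gamma$ an open neighborhood of $\zeta_0$ in $S^{2n-1}$. For $B\subset\mathbb R^n$ open, $\widehat B=B\cup\big(S^{n-1}\infty\setminus\overline{(\mathbb R^n\setminus B)}\big)\subset\mathbb D_{\mathbb R^n}$ (closure in $\mathbb D_{\mathbb R^n}$). For a subset $U\subset\mathbb D_{\mathbb C^n}$, $\mathrm{clos}^1_\infty(U)\subset S^{2n-1}\infty$ is the set of points $z\in S^{2n-1}\infty$ for which there is a sequence $\{z_k\}_{k\in\mathbb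 N}$ in $U\cap\mathbb C^n$ with $z_k\to z$ in $\mathbb D_{\mathbb C^n}$ and $|z_{k+1}|/|z_k|\to1$ as $k\to\infty$. Put $N^1_\infty(U)=S^{2n-1}\infty\setminus\mathrm{clos}^1_\infty(\mathbb C^n\setminus U)$. An open set $U\subset\mathbb D_{\mathbb C^n}$ is regular at $\infty$ if $N^1_\infty(U)=U\cap S^{2n-1}\infty$. *)

theory Defs
  imports "HOL-Analysis.Analysis"
begin

section \<open>Radial compactification\<close>

text \<open>
  \<open>Fin z\<close> is the point \<open>z\<close> and \<open>Dir \<zeta>\<close>, for \<open>\<zeta>\<close> in the unit sphere, the point \<open>\<zeta>\<infinity>\<close>.
  The terms \<open>Dir \<zeta>\<close> with \<open>norm \<zeta> \<noteq> 1\<close> are junk; they lie outside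
  \<open>radial_points\<close>, the carrier of the topology below.
\<close>

datatype 'a radial = Fin 'a | Dir 'a

definition sphere_inf :: "'a::real_normed_vector radial set" where
  "sphere_inf = Dir ` sphere 0 1"

definition radial_points :: "'a::real_normed_vector radial set" where
  "radial_points = range Fin \<union> sphere_inf"

definition cone_nhd :: "real \<Rightarrow> 'a::real_normed_vector set \<Rightarrow> 'a radial set" where
  "cone_nhd r \<Gamma> = Fin ` {z. norm z > r \<and> z /\<^sub>R norm z \<in> \<Gamma>} \<union> Dir ` \<Gamma>"

definition radial_open :: "'a::real_normed_vector radial set \<Rightarrow> bool" where
  "radial_open U \<longleftrightarrow> U \<subseteq> radial_points
     \<and> (\<forall>z. Fin z \<in> U \<longrightarrow> (\<exists>\<epsilon>>0. Fin ` ball z \<epsilon> \<subseteq> U))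
     \<and> (\<forall>\<zeta>. Dir \<zeta> \<in> U \<longrightarrow>
          (\<exists>r>0. \<exists>\<Gamma>. openin (top_of_set (sphere 0 1)) \<Gamma> \<and> \<zeta> \<in> \<Gamma> \<and> cone_nhd r \<Gamma> \<subseteq> U))"

definition radial_top :: "'a::real_normed_vector radial topology" where
  "radial_top = topology radial_open"

lemma cone_nhd_mono: "r' \<le> r \<Longrightarrow> \<Gamma> \<subseteq> \<Gamma>' \<Longrightarrow> cone_nhd r \<Gamma> \<subseteq> cone_nhd r' \<Gamma>'"
  by (auto simp: cone_nhd_def)

lemma istopology_radial_open: "istopology radial_open"
  unfolding istopology_def
proof (intro conjI allI impI)
  fix S T :: "'a radial set"
  assume S: "radial_open S" and T: "radial_open T"
  show "radial_open (S \<inter> T)"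
    unfolding radial_open_def
  proof (intro conjI allI impI)
    show "S \<inter> T \<subseteq> radial_points"
      using S by (auto simp: radial_open_def)
  next
    fix z assume "Fin z \<in> S \<inter> T"
    then have "Fin z \<in> S" "Fin z \<in> T" by auto
    from \<open>Fin z \<in> S\<close> S obtain a where "a > 0" "Fin ` ball z a \<subseteq> S"
      unfolding radial_open_def by blast
    moreover from \<open>Fin z \<in> T\<close> T obtain b where "b > 0" "Fin ` ball z b \<subseteq> T"
      unfolding radial_open_def by blast
    moreover have "Fin ` ball z (min a b) \<subseteq> Fin ` ball z a \<inter> Fin ` ball z b"
      by (auto)
    ultimately show "\<exists>\<epsilon>>0. Fin ` ball z \<epsilon> \<subseteq> S \<inter> T"
      by (intro exI[of _ "min a b"]) auto
  next
    fix \<zeta> assume "Dir \<zeta> \<in> S \<inter> T"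
    then have "Dir \<zeta> \<in> S" "Dir \<zeta> \<in> T" by auto
    from \<open>Dir \<zeta> \<in> S\<close> S obtain a A where a: "a > 0"
        "openin (top_of_set (sphere 0 1)) A" "\<zeta> \<in> A" "cone_nhd a A \<subseteq> S"
      unfolding radial_open_def by blast
    from \<open>Dir \<zeta> \<in> T\<close> T obtain b B where b: "b > 0"
        "openin (top_of_set (sphere 0 1)) B" "\<zeta> \<in> B" "cone_nhd b B \<subseteq> T"
      unfolding radial_open_def by blast
    note * = a b
    have "cone_nhd (max a b) (A \<inter> B) \<subseteq> S \<inter> T"
      using * cone_nhd_mono[of a "max a b" "A \<inter> B" A] cone_nhd_mono[of b "max a b" "A \<inter> B" B]
      by auto
    moreover have "openin (top_of_set (sphere 0 1)) (A \<inter> B)"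
      using a b by blast
    ultimately show "\<exists>r>0. \<exists>\<Gamma>. openin (top_of_set (sphere 0 1)) \<Gamma> \<and> \<zeta> \<in> \<Gamma> \<and> cone_nhd r \<Gamma> \<subseteq> S \<inter> T"
      using a b by (intro exI[of _ "max a b"] conjI exI[of _ "A \<inter> B"]) simp_all
  qed
next
  fix \<K> :: "'a radial set set"
  assume K: "\<forall>S\<in>\<K>. radial_open S"
  show "radial_open (\<Union>\<K>)"
    unfolding radial_open_def
  proof (intro conjI allI impI)
    show "\<Union>\<K> \<subseteq> radial_points"
      using K by (auto simp: radial_open_def)
  next
    fix z assume "Fin z \<in> \<Union>\<K>"
    then obtain S where "S \<in> \<K>" "Fin z \<in> S" by blast
    with K have "radial_open S" by blast
    with \<open>Fin z \<in> S\<close> obtain a where "a > 0" "Fin ` ball z a \<subseteq> S"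
      unfolding radial_open_def by blast
    with \<open>S \<in> \<K>\<close> show "\<exists>\<epsilon>>0. Fin ` ball z \<epsilon> \<subseteq> \<Union>\<K>"
      by blast
  next
    fix \<zeta> assume "Dir \<zeta> \<in> \<Union>\<K>"
    then obtain S where "S \<in> \<K>" "Dir \<zeta> \<in> S" by blast
    with K have "radial_open S" by blast
    with \<open>Dir \<zeta> \<in> S\<close> obtain a A where "a > 0"
        "openin (top_of_set (sphere 0 1)) A" "\<zeta> \<in> A" "cone_nhd a A \<subseteq> S"
      unfolding radial_open_def by blast
    with \<open>S \<in> \<K>\<close> show "\<exists>r>0. \<exists>\<Gamma>. openin (top_of_set (sphere 0 1)) \<Gamma> \<and> \<zeta> \<in> \<Gamma> \<and> cone_nhd r \<Gamma> \<subseteq> \<Union>\<K>"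
      by blast
  qed
qed

lemma openin_radial_top: "openin radial_top U \<longleftrightarrow> radial_open U"
  unfolding radial_top_def by (simp add: topology_inverse' istopology_radial_open)

lemma topspace_radial_top: "topspace radial_top = (radial_points :: 'a::real_normed_vector radial set)"
proof
  show "topspace radial_top \<subseteq> (radial_points :: 'a radial set)"
    unfolding topspace_def openin_radial_top radial_open_def by blast
  have "radial_open (radial_points :: 'a radial set)"
    unfolding radial_open_def
  proof (intro conjI allI impI)
    fix z :: 'a
    show "\<exists>\<epsilon>>0. Fin ` ball z \<epsilon> \<subseteq> radial_points"
      by (intro exI[of _ 1]) (auto simp: radial_points_def)
  next
    fix \<zeta> :: 'a
    assume "Dir \<zeta> \<in> radial_points"
    then show "\<exists>r>0. \<exists>\<Gamma>. openin (top_of_set (sphere 0 1)) \<Gamma> \<and> \<zeta> \<in> \<Gamma> \<and> cone_nhd r \<Gamma> \<subseteq> radial_points"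
      by (intro exI[of _ 1] conjI exI[of _ "sphere 0 1"])
        (auto simp: radial_points_def sphere_inf_def cone_nhd_def)
  qed simp
  then show "(radial_points :: 'a radial set) \<subseteq> topspace radial_top"
    by (simp add: openin_radial_top openin_subset)
qed

definition radial_hat :: "'a::real_normed_vector set \<Rightarrow> 'a radial set" where
  "radial_hat B = Fin ` B \<union> (sphere_inf - radial_top closure_of (Fin ` (- B)))"

text \<open>The inclusion of the compactification of \<open>\<real>\<^sup>n\<close> into that of \<open>\<complex>\<^sup>n\<close>.\<close>

definition real_incl :: "(real ^ 'n) radial \<Rightarrow> (complex ^ 'n::finite) radial" where
  "real_incl = map_radial (\<lambda>x. \<chi> i. complex_of_real (x $ i))"

section \<open>Regularity at infinity\<close>

text \<open>
  In \<open>clos1_inf\<close>, convergence to a point at infinity forces \<open>norm (z k)\<close> to tend to infinity, so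
  the convention \<open>x / 0 = 0\<close> affects only finitely many quotients and not their limit.
\<close>

definition clos1_inf :: "'a::real_normed_vector radial set \<Rightarrow> 'a radial set" where
  "clos1_inf U = {p \<in> sphere_inf. \<exists>z :: nat \<Rightarrow> 'a.
     (\<forall>k. Fin (z k) \<in> U) \<and> limitin radial_top (\<lambda>k. Fin (z k)) p sequentially
     \<and> (\<lambda>k. norm (z (Suc k)) / norm (z k)) \<longlonglongrightarrow> 1}"

definition N1_inf :: "'a::real_normed_vector radial set \<Rightarrow> 'a radial set" where
  "N1_inf U = sphere_inf - clos1_inf (range Fin - U)"

definition regular_at_inf :: "'a::real_normed_vector radial set \<Rightarrow> bool" where
  "regular_at_inf U \<longleftrightarrow> openin radial_top U \<and> N1_inf U = U \<inter> sphere_inf"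

section \<open>Stein open subsets of complex n-space\<close>

definition holomorphic_vec_on :: "(complex ^ 'n::finite \<Rightarrow> complex) \<Rightarrow> (complex ^ 'n) set \<Rightarrow> bool" where
  "holomorphic_vec_on f U \<longleftrightarrow>
     (\<forall>z\<in>U. \<exists>L. (f has_derivative L) (at z) \<and> (\<forall>c v. L (c *s v) = c * L v))"

text \<open>
  The condition \<open>norm (f z) \<le> sup\<^sub>K norm f\<close> is phrased through upper bounds, so that the hull of
  the empty set is empty.
\<close>

definition holomorphic_hull :: "(complex ^ 'n::finite) set \<Rightarrow> (complex ^ 'n) set \<Rightarrow> (complex ^ 'n) set" where
  "holomorphic_hull U K = {z \<in> U. \<forall>f M. holomorphic_vec_on f U \<longrightarrow>
     (\<forall>w\<in>K. norm (f w) \<le> M) \<longrightarrow> norm (f z) \<le> M}"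

text \<open>
  The usual definition of a Stein manifold (holomorphically convex and holomorphically separable),
  applied to an open submanifold of \<open>\<complex>\<^sup>n\<close>; connectedness is not required.
\<close>

definition stein_open :: "(complex ^ 'n::finite) set \<Rightarrow> bool" where
  "stein_open U \<longleftrightarrow> open U
     \<and> (\<forall>K. compact K \<and> K \<subseteq> U \<longrightarrow> compact (holomorphic_hull U K))
     \<and> (\<forall>z\<in>U. \<forall>w\<in>U. z \<noteq> w \<longrightarrow> (\<exists>f. holomorphic_vec_on f U \<and> f z \<noteq> f w))"

section \<open>Conic sets\<close>

definition Rplus_conic :: "'a::real_vector set \<Rightarrow> bool" where
  "Rplus_conic S \<longleftrightarrow> (\<forall>t>0. \<forall>x\<in>S. t *\<^sub>R x \<in> S)"

end

theory Submission
  imports Defs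
begin

text \<open>
  Write \<open>z = x + \<i>y\<close> with \<open>x, y\<close> real vectors. The finite part of \<open>U\<close> is a tube
  \<open>W = {z. norm y < infdist (x, 0) A}\<close> for a nonempty set \<open>A\<close> of points \<open>(b, s)\<close> in
  \<open>\<real>\<^sup>n \<times> \<real>\<close>. Every such tube is Stein (\<open>stein_open_dist_tube\<close>): for
  \<open>q\<^sub>b z = (\<Sum>i. (z\<^sub>i - b\<^sub>i)\<^sup>2)\<close> one has \<open>Re (q\<^sub>b z) = norm (x - b)\<^sup>2 - norm y\<^sup>2\<close>, so the tube
  is described by the inequalities \<open>- Re (q\<^sub>b z) < s\<^sup>2\<close>, with a margin uniform in
  \<open>(b, s) \<in> A\<close>, and the entire functions \<open>exp (- q\<^sub>b)\<close> carry the margin of a compact set over to its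
  holomorphic hull.

  To fit the tube into \<open>V\<close>, let \<open>T\<close> be the set of \<open>w\<close> with \<open>2 * norm (Im w) < norm (Re w)\<close> whose
  closed ray \<open>{t w | t \<ge> 1} \<union> {w\<infinity>}\<close> lies in \<open>V\<close>. It is stable under dilations by
  \<open>t \<ge> 1\<close>, and by compactness of the rays (\<open>in_interior_ray_core\<close>) it is a neighbourhood of
  \<open>\<Omega> - {0}\<close>. Put \<open>M = T \<union> ball 0 \<delta>\<close> with a ball contained in \<open>V\<close>; it is needed only
  when \<open>0 \<in> \<Omega>\<close>, and \<open>\<delta> = 0\<close> otherwise. The complement of \<open>A\<close> consists of the \<open>(x, s)\<close> such that
  \<open>x + \<i>y \<in> M\<close> whenever \<open>norm y \<le> \<bar>s\<bar>\<close>. Then \<open>\<Omega> \<subseteq> W \<subseteq> M\<close>, and outside the ball of radius \<open>3\<delta>\<close> the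
  tube \<open>W\<close> is contained in \<open>T\<close> and stable under dilations by \<open>t \<ge> 1\<close>.

  Finally, \<open>\<zeta>\<infinity>\<close> belongs to \<open>U\<close> iff \<open>s\<zeta> \<in> W\<close> for some \<open>s > 3\<delta>\<close>. By stability under dilations
  the tube then contains a conic neighbourhood of \<open>\<zeta>\<infinity>\<close>, so \<open>U\<close> is open; in the other
  case the far part of the ray through \<open>\<zeta>\<close> avoids \<open>W\<close> entirely, and equally spaced points on it
  witness \<open>\<zeta>\<infinity> \<notin> N\<^sup>1\<^sub>\<infinity>(U)\<close>. This is regularity at infinity (\<open>regular_at_inf_far_cone\<close>).
\<close>

section \<open>Real and imaginary parts of complex vectors\<close>

text \<open>Componentwise real and imaginary parts, and the inclusion of \<open>\<real>\<^sup>n\<close> into \<open>\<complex>\<^sup>n\<close>.\<close>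

definition re_vec :: "complex ^ 'n \<Rightarrow> real ^ 'n::finite" where
  "re_vec z = (\<chi> i. Re (z $ i))"

definition im_vec :: "complex ^ 'n \<Rightarrow> real ^ 'n::finite" where
  "im_vec z = (\<chi> i. Im (z $ i))"

definition real_vec :: "real ^ 'n \<Rightarrow> complex ^ 'n::finite" where
  "real_vec x = (\<chi> i. complex_of_real (x $ i))"

lemma bounded_linear_re_vec: "bounded_linear re_vec"
  and bounded_linear_im_vec: "bounded_linear im_vec"
  and bounded_linear_real_vec: "bounded_linear real_vec"
  by (auto intro!: linear_conv_bounded_linear[THEN iffD1] linearI
      simp: re_vec_def im_vec_def real_vec_def vec_eq_iff complex_eq_iff)

lemmas re_vec_simps [simp] = linear_simps[OF bounded_linear_re_vec]
lemmas im_vec_simps [simp] = linear_simps[OF bounded_linear_im_vec]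
lemmas real_vec_simps [simp] = linear_simps[OF bounded_linear_real_vec]

lemmas continuous_on_re_vec [continuous_intros] =
  bounded_linear.continuous_on[OF bounded_linear_re_vec]
lemmas continuous_on_im_vec [continuous_intros] =
  bounded_linear.continuous_on[OF bounded_linear_im_vec]

lemma re_vec_real_vec [simp]: "re_vec (real_vec x) = x"
  and im_vec_real_vec [simp]: "im_vec (real_vec x) = 0"
  by (simp_all add: re_vec_def im_vec_def real_vec_def vec_eq_iff)

lemma power2_norm_vec: "(norm (z :: 'a::real_normed_vector ^ 'n::finite))\<^sup>2 = (\<Sum>i\<in>UNIV. (norm (z $ i))\<^sup>2)"
  by (simp add: norm_vec_def L2_set_def sum_nonneg)

lemma power2_norm_re_im:
  "(norm z)\<^sup>2 = (norm (re_vec z))\<^sup>2 + (norm (im_vec z))\<^sup>2"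
  by (simp add: power2_norm_vec re_vec_def im_vec_def cmod_power2 sum.distrib)

lemma norm_re_vec_le: "norm (re_vec z) \<le> norm z"
  by (rule power2_le_imp_le) (simp_all add: power2_norm_re_im)

lemma norm_le_re_im: "norm z \<le> norm (re_vec z) + norm (im_vec z)"
  by (rule power2_le_imp_le) (simp_all add: power2_norm_re_im power2_sum)

lemma norm_real_vec [simp]: "norm (real_vec x) = norm x"
  using power2_norm_re_im[of "real_vec x"] by simp

lemma real_vec_eq_0_iff [simp]: "real_vec x = 0 \<longleftrightarrow> x = 0"
  by (metis norm_eq_zero norm_real_vec)

lemma exists_im_vec:
  fixes y :: "real ^ 'n::finite"
  shows "\<exists>z. re_vec z = 0 \<and> im_vec z = y"
  by (rule exI[of _ "\<chi> i. \<i> * complex_of_real (y $ i)"])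
    (simp add: re_vec_def im_vec_def vec_eq_iff)

lemma real_incl_Fin: "real_incl (Fin x) = Fin (real_vec x)"
  and real_incl_Dir: "real_incl (Dir x) = Dir (real_vec x)"
  by (simp_all add: real_incl_def real_vec_def)


section \<open>Stein tubes\<close>

text \<open>
  The holomorphic extension \<open>q\<^sub>b\<close> to \<open>\<complex>\<^sup>n\<close> of the squared distance from the real point \<open>b\<close>.
\<close>

definition sq_dist_poly :: "real ^ 'n \<Rightarrow> complex ^ 'n::finite \<Rightarrow> complex" where
  "sq_dist_poly b z = (\<Sum>i\<in>UNIV. (z $ i - complex_of_real (b $ i))\<^sup>2)"

lemma Re_sq_dist_poly:
  "Re (sq_dist_poly b z) = (norm (re_vec z - b))\<^sup>2 - (norm (im_vec z))\<^sup>2"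
  by (simp add: sq_dist_poly_def power2_norm_vec re_vec_def im_vec_def sum_subtractf Re_power2)

lemma holomorphic_vec_on_nth: "holomorphic_vec_on (\<lambda>z. z $ i) U"
  unfolding holomorphic_vec_on_def
  by (intro ballI exI[of _ "\<lambda>v. v $ i"])
    (simp add: bounded_linear_imp_has_derivative bounded_linear_vec_nth)

lemma holomorphic_vec_on_exp_sq_dist: "holomorphic_vec_on (\<lambda>z. exp (- sq_dist_poly b z)) U"
  unfolding holomorphic_vec_on_def
proof
  fix z :: "complex ^ 'a"
  have nth: "((\<lambda>z. z $ i) has_derivative (\<lambda>v. v $ i)) (at z)" for i
    by (simp add: bounded_linear_imp_has_derivative bounded_linear_vec_nth)
  let ?L = "\<lambda>v. - exp (- sq_dist_poly b z) * (\<Sum>i\<in>UNIV. 2 * (z $ i - complex_of_real (b $ i)) * v $ i)"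
  have "((\<lambda>z. (z $ i - complex_of_real (b $ i))\<^sup>2) has_derivative
      (\<lambda>v. 2 * (z $ i - complex_of_real (b $ i)) * v $ i)) (at z)" for i
    by (rule derivative_eq_intros nth refl | simp add: fun_eq_iff)+
  then have "(sq_dist_poly b has_derivative
      (\<lambda>v. \<Sum>i\<in>UNIV. 2 * (z $ i - complex_of_real (b $ i)) * v $ i)) (at z)"
    unfolding sq_dist_poly_def by (intro has_derivative_sum)
  from has_derivative_compose[OF has_derivative_minus[OF this]
      DERIV_exp[unfolded has_field_derivative_def]]
  have "((\<lambda>z. exp (- sq_dist_poly b z)) has_derivative ?L) (at z)"
    by simp
  moreover have "?L (c *s v) = c * ?L v" for c v
    by (simp add: sum_distrib_left mult_ac)
  ultimately show "\<exists>L. ((\<lambda>z. exp (- sq_dist_poly b z)) has_derivative L) (at z)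
      \<and> (\<forall>c v. L (c *s v) = c * L v)"
    by blast
qed

lemma holomorphic_vec_on_imp_isCont:
  assumes "holomorphic_vec_on f U" "z \<in> U"
  shows "isCont f z"
  using assms unfolding holomorphic_vec_on_def by (auto dest: has_derivative_continuous)

lemma holomorphic_hull_norm_le:
  assumes "z \<in> holomorphic_hull U K" "holomorphic_vec_on f U" "\<And>w. w \<in> K \<Longrightarrow> norm (f w) \<le> m"
  shows "norm (f z) \<le> m"
  using assms by (simp add: holomorphic_hull_def)

text \<open>
  The coordinate functions bound the hull and separate points, so a Stein open set is obtained
  as soon as hulls of compact sets stay in a closed subset of \<open>\<complex>\<^sup>n\<close> that is contained in \<open>U\<close>.
\<close>

lemma stein_openI:
  assumes "open U"
    and hull: "\<And>K. compact K \<Longrightarrow> K \<subseteq> U \<Longrightarrow> \<exists>C. closed C \<and> C \<subseteq> U \<and> holomorphic_hull U K \<subseteq> C"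
  shows "stein_open U"
  unfolding stein_open_def
proof (intro conjI allI impI ballI)
  fix K assume "compact K \<and> K \<subseteq> U"
  then have K: "compact K" "K \<subseteq> U" by simp_all
  from hull[OF this] obtain C where C: "closed C" "C \<subseteq> U" "holomorphic_hull U K \<subseteq> C"
    by (elim exE conjE)
  obtain B where B: "\<And>w. w \<in> K \<Longrightarrow> norm w \<le> B"
    using compact_imp_bounded[OF K(1)] by (auto simp: bounded_iff)
  have "norm z \<le> (\<Sum>i\<in>(UNIV::'a set). B)" if z: "z \<in> holomorphic_hull U K" for z
  proof -
    have "norm (z $ i) \<le> B" for i
      by (rule holomorphic_hull_norm_le[OF z holomorphic_vec_on_nth])
        (auto intro: order_trans[OF Finite_Cartesian_Product.norm_nth_le] B)
    then have "(\<Sum>i\<in>UNIV. norm (z $ i)) \<le> (\<Sum>i\<in>(UNIV::'a set). B)"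
      by (intro sum_mono)
    moreover have "norm z \<le> (\<Sum>i\<in>UNIV. norm (z $ i))"
      unfolding norm_vec_def by (rule L2_set_le_sum) simp
    ultimately show ?thesis by linarith
  qed
  then have "bounded (holomorphic_hull U K)"
    unfolding bounded_iff by blast
  moreover have "closed (holomorphic_hull U K)"
    unfolding closed_sequential_limits
  proof (intro allI impI, elim conjE)
    fix x l assume x: "\<forall>k. x k \<in> holomorphic_hull U K" and l: "x \<longlonglongrightarrow> l"
    have "l \<in> C"
      using x l C closed_sequentially[of C x l] by blast
    with C have "l \<in> U" by blast
    moreover have "norm (f l) \<le> m"
      if f: "holomorphic_vec_on f U" "\<forall>w\<in>K. norm (f w) \<le> m" for f m
    proof (rule LIMSEQ_le_const2)
      show "(\<lambda>k. norm (f (x k))) \<longlonglongrightarrow> norm (f l)"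
        by (rule tendsto_norm[OF isCont_tendsto_compose[OF
              holomorphic_vec_on_imp_isCont[OF f(1) \<open>l \<in> U\<close>] l]])
      show "\<exists>N. \<forall>n\<ge>N. norm (f (x n)) \<le> m"
        using x f by (simp add: holomorphic_hull_def)
    qed
    ultimately show "l \<in> holomorphic_hull U K"
      unfolding holomorphic_hull_def by blast
  qed
  ultimately show "compact (holomorphic_hull U K)"
    by (simp add: compact_eq_bounded_closed)
next
  fix z w :: "complex ^ 'a" assume "z \<noteq> w"
  then obtain i where "z $ i \<noteq> w $ i" by (auto simp: vec_eq_iff)
  then show "\<exists>f. holomorphic_vec_on f U \<and> f z \<noteq> f w"
    using holomorphic_vec_on_nth by blast
qed (fact assms)

text \<open>
  The tube around \<open>\<real>\<^sup>n\<close> whose radius over \<open>x\<close> is the distance from \<open>(x, 0)\<close> to \<open>A\<close>.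
  As \<open>infdist p {} = 0\<close>, the tube of the empty set is empty.
\<close>

definition dist_tube :: "((real ^ 'n) \<times> real) set \<Rightarrow> (complex ^ 'n::finite) set" where
  "dist_tube A = {z. norm (im_vec z) < infdist (re_vec z, 0) A}"

lemma open_dist_tube: "open (dist_tube A)"
  unfolding dist_tube_def by (intro open_Collect_less continuous_intros)

lemma dist_pair_0_power2: "(dist (x, 0::real) (b, s))\<^sup>2 = (norm (x - b))\<^sup>2 + s\<^sup>2"
  for x b :: "'a::real_normed_vector"
  by (simp add: dist_Pair_Pair dist_norm[of x])

lemma stein_open_dist_tube:
  assumes "A \<noteq> {}"
  shows "stein_open (dist_tube A)"
proof (rule stein_openI[OF open_dist_tube])
  fix K :: "(complex ^ 'a) set"
  assume K: "compact K" "K \<subseteq> dist_tube A"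
  let ?h = "\<lambda>z :: complex ^ 'a. (infdist (re_vec z, 0) A)\<^sup>2 - (norm (im_vec z))\<^sup>2"
  have cont: "continuous_on S ?h" for S
    by (intro continuous_intros)
  have h_pos: "z \<in> dist_tube A \<longleftrightarrow> 0 < ?h z" for z
    using power_strict_mono[of "norm (im_vec z)" "infdist (re_vec z, 0) A" 2]
      power2_less_imp_less[of "norm (im_vec z)" "infdist (re_vec z, 0) A"]
    by (auto simp: dist_tube_def infdist_nonneg)
  obtain \<eta> where \<eta>: "\<eta> > 0" "\<And>w. w \<in> K \<Longrightarrow> \<eta> \<le> ?h w"
  proof (cases "K = {}")
    case False
    then obtain w0 where "w0 \<in> K" "\<forall>w\<in>K. ?h w0 \<le> ?h w"
      using continuous_attains_inf[OF K(1) _ cont] by blast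
    then show ?thesis
      using that K(2) h_pos by blast
  qed (use that[of 1] in auto)
  let ?C = "{z. \<eta> \<le> ?h z}"
  have "closed ?C"
    by (intro closed_Collect_le continuous_on_const cont)
  moreover have "?C \<subseteq> dist_tube A"
  proof
    fix z assume "z \<in> ?C"
    then have "0 < ?h z" using \<eta>(1) by simp
    then show "z \<in> dist_tube A" by (simp only: h_pos)
  qed
  moreover have "holomorphic_hull (dist_tube A) K \<subseteq> ?C"
  proof
    fix z assume z: "z \<in> holomorphic_hull (dist_tube A) K"
    have le: "(norm (im_vec z))\<^sup>2 + \<eta> \<le> (dist (re_vec z, 0) p)\<^sup>2" if "p \<in> A" for p
    proof -
      obtain b s where p: "p = (b, s)" by (cases p)
      \<comment> \<open>In terms of moduli of \<open>exp (- q\<^sub>b)\<close>, the inequality is inherited by the hull.\<close>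
      have "norm (exp (- sq_dist_poly b w)) \<le> exp (s\<^sup>2 - \<eta>)" if "w \<in> K" for w
      proof -
        have "(infdist (re_vec w, 0) A)\<^sup>2 \<le> (dist (re_vec w, 0) p)\<^sup>2"
          using \<open>p \<in> A\<close> by (intro power_mono infdist_le infdist_nonneg)
        with \<eta>(2)[OF that] show ?thesis
          by (simp add: p dist_pair_0_power2 Re_sq_dist_poly)
      qed
      then have "norm (exp (- sq_dist_poly b z)) \<le> exp (s\<^sup>2 - \<eta>)"
        by (rule holomorphic_hull_norm_le[OF z holomorphic_vec_on_exp_sq_dist])
      then show ?thesis
        by (simp add: p dist_pair_0_power2 Re_sq_dist_poly)
    qed
    have "sqrt ((norm (im_vec z))\<^sup>2 + \<eta>) \<le> infdist (re_vec z, 0) A"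
      unfolding infdist_notempty[OF assms]
      using assms le by (intro cINF_greatest real_le_lsqrt) (auto simp: real_le_lsqrt)
    then have "(norm (im_vec z))\<^sup>2 + \<eta> \<le> (infdist (re_vec z, 0) A)\<^sup>2"
      using \<eta>(1) by (simp add: sqrt_le_D)
    then show "z \<in> ?C" by simp
  qed
  ultimately show "\<exists>C. closed C \<and> C \<subseteq> dist_tube A \<and> holomorphic_hull (dist_tube A) K \<subseteq> C"
    by blast
qed

lemma infdist_scaleR_ge:
  fixes A :: "'a::real_normed_vector set"
  assumes "A \<noteq> {}" "t > 0" and A: "\<And>b. b \<in> A \<Longrightarrow> b /\<^sub>R t \<in> A"
  shows "t * infdist p A \<le> infdist (t *\<^sub>R p) A"
  unfolding infdist_notempty[of A "t *\<^sub>R p", OF assms(1)]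
proof (rule cINF_greatest[OF assms(1)])
  fix b assume "b \<in> A"
  have "dist (t *\<^sub>R p) b = t * dist p (b /\<^sub>R t)"
  proof -
    have "t *\<^sub>R p - b = t *\<^sub>R (p - b /\<^sub>R t)"
      using assms(2) by (simp add: scaleR_diff_right)
    then show ?thesis using assms(2) by (simp add: dist_norm)
  qed
  then show "t * infdist p A \<le> dist (t *\<^sub>R p) b"
    using infdist_le[OF A[OF \<open>b \<in> A\<close>], of p] assms(2) by simp
qed


section \<open>Topology of the radial compactification\<close>

lemma limitin_ray:
  fixes \<zeta> :: "'a::real_normed_vector"
  assumes "norm \<zeta> = 1"
  shows "limitin radial_top (\<lambda>k. Fin ((real k + c) *\<^sub>R \<zeta>)) (Dir \<zeta>) sequentially"
  unfolding limitin_def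
proof (intro conjI allI impI)
  show "Dir \<zeta> \<in> topspace radial_top"
    using assms by (simp add: topspace_radial_top radial_points_def sphere_inf_def)
next
  fix U :: "'a radial set" assume "openin radial_top U \<and> Dir \<zeta> \<in> U"
  then obtain r \<Gamma> where r: "r > 0" "\<zeta> \<in> \<Gamma>" "cone_nhd r \<Gamma> \<subseteq> U"
    unfolding openin_radial_top radial_open_def by blast
  have "\<forall>\<^sub>F k in sequentially. real k > r + \<bar>c\<bar>"
    using filterlim_real_sequentially by (simp add: filterlim_at_top_dense)
  then show "\<forall>\<^sub>F k in sequentially. Fin ((real k + c) *\<^sub>R \<zeta>) \<in> U"
  proof eventually_elim
    case (elim k)
    then have "Fin ((real k + c) *\<^sub>R \<zeta>) \<in> cone_nhd r \<Gamma>"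
      using r assms by (auto simp: cone_nhd_def)
    then show ?case using r by blast
  qed
qed

lemma ray_ratio_tendsto_1:
  assumes "norm \<zeta> = 1" "c \<ge> 0"
  shows "(\<lambda>k. norm ((real (Suc k) + c) *\<^sub>R \<zeta>) / norm ((real k + c) *\<^sub>R \<zeta>)) \<longlonglongrightarrow> 1"
proof (rule Lim_transform_eventually)
  have "filterlim (\<lambda>k. c + real k) at_top sequentially"
    by (intro filterlim_tendsto_add_at_top[OF tendsto_const] filterlim_real_sequentially)
  then have "(\<lambda>k. 1 + 1 / (c + real k)) \<longlonglongrightarrow> 1 + 0"
    by (intro tendsto_intros tendsto_divide_0[OF tendsto_const] filterlim_at_top_imp_at_infinity)
  then show "(\<lambda>k. 1 + 1 / (c + real k)) \<longlonglongrightarrow> 1" by simp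
  show "\<forall>\<^sub>F k in sequentially. 1 + 1 / (c + real k)
      = norm ((real (Suc k) + c) *\<^sub>R \<zeta>) / norm ((real k + c) *\<^sub>R \<zeta>)"
    using eventually_gt_at_top[of 0]
  proof eventually_elim
    case (elim k)
    then show ?case
      using assms unfolding norm_scaleR by (simp add: field_simps)
  qed
qed

lemma openin_sphere_directions:
  assumes "openin (top_of_set (sphere 0 1)) \<Gamma>"
  shows "open {w::'a::real_normed_vector. w \<noteq> 0 \<and> w /\<^sub>R norm w \<in> \<Gamma>}"
proof -
  obtain Q where Q: "open Q" "\<Gamma> = sphere 0 1 \<inter> Q"
    using assms by (auto simp: openin_open)
  have "open (- {0} \<inter> (\<lambda>w::'a. w /\<^sub>R norm w) -` Q)"
    using Q by (intro continuous_open_preimage) (auto intro!: continuous_intros)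
  moreover have "{w::'a. w \<noteq> 0 \<and> w /\<^sub>R norm w \<in> \<Gamma>} = - {0} \<inter> (\<lambda>w::'a. w /\<^sub>R norm w) -` Q"
    using Q by auto
  ultimately show ?thesis by simp
qed

text \<open>
  For a conic open set, a direction is interior at infinity iff it belongs to the set: if not, its
  whole ray lies in the complement.
\<close>

lemma radial_hat_conic:
  fixes \<Omega> :: "'a::real_normed_vector set"
  assumes "open \<Omega>" "Rplus_conic \<Omega>"
  shows "radial_hat \<Omega> = Fin ` \<Omega> \<union> Dir ` (\<Omega> \<inter> sphere 0 1)"
proof -
  have scale: "t *\<^sub>R x \<in> \<Omega> \<longleftrightarrow> x \<in> \<Omega>" if "t > 0" for t x
  proof
    assume "t *\<^sub>R x \<in> \<Omega>"
    then have "inverse t *\<^sub>R (t *\<^sub>R x) \<in> \<Omega>"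
      using assms(2) that unfolding Rplus_conic_def by (metis inverse_positive_iff_positive)
    then show "x \<in> \<Omega>" using that by simp
  qed (use assms(2) that in \<open>auto simp: Rplus_conic_def\<close>)
  have "Dir \<zeta> \<in> radial_top closure_of (Fin ` (- \<Omega>)) \<longleftrightarrow> \<zeta> \<notin> \<Omega>" if \<zeta>: "norm \<zeta> = 1" for \<zeta>
  proof
    assume "\<zeta> \<notin> \<Omega>"
    then have "Fin ((real k + 1) *\<^sub>R \<zeta>) \<in> Fin ` (- \<Omega>)" for k
      using scale[of "real k + 1" \<zeta>] by auto
    then show "Dir \<zeta> \<in> radial_top closure_of (Fin ` (- \<Omega>))"
      using limitin_ray[OF \<zeta>, of 1]
      unfolding in_closure_of limitin_def eventually_sequentially by blast
  next
    assume cl: "Dir \<zeta> \<in> radial_top closure_of (Fin ` (- \<Omega>))"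
    show "\<zeta> \<notin> \<Omega>"
    proof
      assume "\<zeta> \<in> \<Omega>"
      let ?\<Gamma> = "\<Omega> \<inter> sphere 0 1"
      have \<Gamma>: "openin (top_of_set (sphere 0 1)) ?\<Gamma>"
        using assms(1) by (auto simp: openin_open)
      have fin: "{z::'a. norm z > 1 \<and> z /\<^sub>R norm z \<in> ?\<Gamma>} = \<Omega> \<inter> {z. norm z > 1}"
      proof -
        have "z /\<^sub>R norm z \<in> \<Omega> \<longleftrightarrow> z \<in> \<Omega>" if "norm z > 1" for z
          by (rule scale) (use that in auto)
        moreover have "norm (z /\<^sub>R norm z) = 1" if "norm z > 1" for z :: 'a
          using that by (cases "z = 0") auto
        ultimately show ?thesis by auto
      qed
      have "open (\<Omega> \<inter> {z. norm z > 1})"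
        by (intro open_Int assms(1) open_Collect_less continuous_intros)
      then have ball: "\<exists>e>0. ball z e \<subseteq> \<Omega> \<inter> {z. norm z > 1}" if "z \<in> \<Omega>" "norm z > 1" for z
        using that unfolding open_contains_ball by blast
      have "radial_open (cone_nhd 1 ?\<Gamma>)"
        unfolding radial_open_def
      proof (intro conjI allI impI)
        show "cone_nhd 1 ?\<Gamma> \<subseteq> radial_points"
          by (auto simp: cone_nhd_def radial_points_def sphere_inf_def)
      next
        fix z assume "Fin z \<in> cone_nhd 1 ?\<Gamma>"
        then have "z \<in> \<Omega>" "norm z > 1"
          unfolding cone_nhd_def fin by auto
        then obtain e where "e > 0" "ball z e \<subseteq> \<Omega> \<inter> {z. norm z > 1}"
          using ball by blast
        then show "\<exists>e>0. Fin ` ball z e \<subseteq> cone_nhd 1 ?\<Gamma>"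
          unfolding cone_nhd_def fin by blast
      next
        fix \<xi> assume "Dir \<xi> \<in> cone_nhd 1 ?\<Gamma>"
        then have "\<xi> \<in> ?\<Gamma>" by (auto simp: cone_nhd_def)
        with \<Gamma> show "\<exists>r>0. \<exists>\<Gamma>. openin (top_of_set (sphere 0 1)) \<Gamma> \<and> \<xi> \<in> \<Gamma>
            \<and> cone_nhd r \<Gamma> \<subseteq> cone_nhd 1 ?\<Gamma>"
          by (intro exI[of _ 1] conjI exI[of _ ?\<Gamma>]) simp_all
      qed
      moreover have "Dir \<zeta> \<in> cone_nhd 1 ?\<Gamma>"
        using \<open>\<zeta> \<in> \<Omega>\<close> \<zeta> by (simp add: cone_nhd_def)
      ultimately have "\<exists>y. y \<in> Fin ` (- \<Omega>) \<and> y \<in> cone_nhd 1 ?\<Gamma>"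
        using cl unfolding in_closure_of openin_radial_top by blast
      then show False
        unfolding cone_nhd_def fin by auto
    qed
  qed
  then show ?thesis
    unfolding radial_hat_def sphere_inf_def by auto
qed

lemma open_Fin_vimage:
  assumes "openin radial_top V"
  shows "open (Fin -` V)"
  unfolding open_contains_ball
proof
  fix z assume "z \<in> Fin -` V"
  then obtain e where "e > 0" "Fin ` ball z e \<subseteq> V"
    using assms unfolding openin_radial_top radial_open_def by blast
  then show "\<exists>e>0. ball z e \<subseteq> Fin -` V" by blast
qed

text \<open>
  The points whose closed ray outwards to infinity, including the point at infinity, lies in \<open>V\<close>.
  The origin, which has no direction, is excluded.
\<close>

definition ray_core :: "'a::real_normed_vector radial set \<Rightarrow> 'a set" where
  "ray_core V = {w. w \<noteq> 0 \<and> Dir (w /\<^sub>R norm w) \<in> V \<and> (\<forall>t\<ge>1. Fin (t *\<^sub>R w) \<in> V)}"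

lemma ray_core_scaleR:
  assumes "w \<in> ray_core V" "t \<ge> 1"
  shows "t *\<^sub>R w \<in> ray_core V"
proof -
  have "Fin (u *\<^sub>R t *\<^sub>R w) \<in> V" if "u \<ge> 1" for u
  proof -
    have "u * t \<ge> 1 * 1" using assms(2) that by (intro mult_mono) auto
    then show ?thesis using assms(1) by (simp add: ray_core_def)
  qed
  moreover have "(t *\<^sub>R w) /\<^sub>R norm (t *\<^sub>R w) = w /\<^sub>R norm w"
    using assms(2) by simp
  then have "Dir ((t *\<^sub>R w) /\<^sub>R norm (t *\<^sub>R w)) \<in> V"
    using assms(1) by (simp only: ray_core_def mem_Collect_eq)
  moreover have "t *\<^sub>R w \<noteq> 0"
    using assms by (simp add: ray_core_def)
  ultimately show ?thesis
    unfolding ray_core_def by blast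
qed

lemma in_interior_ray_core:
  fixes x :: "'a::real_normed_vector"
  assumes V: "openin radial_top V" and x: "x \<in> ray_core V"
  shows "x \<in> interior (ray_core V)"
proof -
  have "x \<noteq> 0" and dir: "Dir (x /\<^sub>R norm x) \<in> V" and fin: "\<And>t. t \<ge> 1 \<Longrightarrow> Fin (t *\<^sub>R x) \<in> V"
    using x by (auto simp: ray_core_def)
  obtain r \<Gamma> where r: "r > 0" "openin (top_of_set (sphere 0 1)) \<Gamma>" "x /\<^sub>R norm x \<in> \<Gamma>"
      "cone_nhd r \<Gamma> \<subseteq> V"
    using V dir unfolding openin_radial_top radial_open_def by blast
  obtain e1 where e1: "e1 > 0" "ball x e1 \<subseteq> {w. w \<noteq> 0 \<and> w /\<^sub>R norm w \<in> \<Gamma>}"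
    using openin_sphere_directions[OF r(2)] r(3) \<open>x \<noteq> 0\<close> unfolding open_contains_ball by blast
  define t1 where "t1 = 2 * r / norm x + 1"
  have "t1 \<ge> 1" using r(1) by (simp add: t1_def)
  \<comment> \<open>Near \<open>x\<close>, multiples by \<open>t > t1\<close> lie in the conic neighbourhood; for \<open>t \<le> t1\<close> a compact
    segment remains.\<close>
  have "compact ((\<lambda>t. t *\<^sub>R x) ` {1..t1})"
    by (intro compact_continuous_image continuous_intros compact_Icc)
  then obtain e2 where e2: "e2 > 0" "(\<Union>y\<in>(\<lambda>t. t *\<^sub>R x) ` {1..t1}. ball y e2) \<subseteq> Fin -` V"
    by (rule compact_subset_open_imp_ball_epsilon_subset[OF _ open_Fin_vimage[OF V]])
      (use fin in auto)
  define e where "e = min (min e1 (e2 / t1)) (norm x / 2)"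
  have "e > 0"
    using e1(1) e2(1) \<open>t1 \<ge> 1\<close> \<open>x \<noteq> 0\<close> by (simp add: e_def)
  have "w \<in> ray_core V" if w: "w \<in> ball x e" for w
  proof -
    have "norm (x - w) < e" using w by (simp add: dist_norm)
    have \<Gamma>: "w \<noteq> 0" "w /\<^sub>R norm w \<in> \<Gamma>"
      using e1(2) w by (auto simp: e_def)
    have "Fin (t *\<^sub>R w) \<in> V" if "t \<ge> 1" for t
    proof (cases "t \<le> t1")
      case True
      have "norm (t *\<^sub>R x - t *\<^sub>R w) = t * norm (x - w)"
        using \<open>t \<ge> 1\<close> by (simp flip: scaleR_diff_right)
      also have "\<dots> \<le> t1 * norm (x - w)"
        using True by (intro mult_right_mono) auto
      also have "\<dots> < t1 * (e2 / t1)"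
        using \<open>norm (x - w) < e\<close> \<open>t1 \<ge> 1\<close> by (intro mult_strict_left_mono) (auto simp: e_def)
      finally have "t *\<^sub>R w \<in> ball (t *\<^sub>R x) e2"
        using \<open>t1 \<ge> 1\<close> by (simp add: dist_norm)
      then show ?thesis
        using e2(2) True \<open>t \<ge> 1\<close> by fastforce
    next
      case False
      have "norm w > norm x / 2"
        using \<open>norm (x - w) < e\<close> norm_triangle_ineq2[of x w] by (simp add: e_def)
      moreover have "t > 2 * r / norm x"
        using False by (simp add: t1_def)
      ultimately have "(2 * r / norm x) * (norm x / 2) < t * norm w"
        using r(1) \<open>x \<noteq> 0\<close> \<open>t \<ge> 1\<close> by (intro mult_strict_mono) auto
      then have "norm (t *\<^sub>R w) > r"
        using \<open>x \<noteq> 0\<close> \<open>t \<ge> 1\<close> by simp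
      moreover have "(t *\<^sub>R w) /\<^sub>R norm (t *\<^sub>R w) = w /\<^sub>R norm w"
        using \<open>t \<ge> 1\<close> by simp
      ultimately have "Fin (t *\<^sub>R w) \<in> cone_nhd r \<Gamma>"
        using \<Gamma>(2) unfolding cone_nhd_def by (intro UnI1 imageI CollectI conjI) (simp_all only:)
      then show ?thesis using r(4) by blast
    qed
    moreover have "Dir (w /\<^sub>R norm w) \<in> V"
      using \<Gamma> r(4) by (auto simp: cone_nhd_def)
    ultimately show ?thesis
      using \<Gamma>(1) by (simp add: ray_core_def)
  qed
  then show ?thesis
    using \<open>e > 0\<close> unfolding mem_interior by blast
qed


section \<open>Tubes stable under dilations and their points at infinity\<close>

text \<open>
  The pairs \<open>(x, s)\<close> such that the closed ball of radius \<open>\<bar>s\<bar>\<close> in the imaginary directions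
  around \<open>x\<close> lies in \<open>M\<close>. The tube of the complement of this set lies in \<open>M\<close> and, if that
  complement is nonempty, contains all real points interior to \<open>M\<close>.
\<close>

definition tube_base :: "(complex ^ 'n) set \<Rightarrow> ((real ^ 'n::finite) \<times> real) set" where
  "tube_base M = {(x, s). \<forall>z. re_vec z = x \<longrightarrow> norm (im_vec z) \<le> \<bar>s\<bar> \<longrightarrow> z \<in> M}"

lemma dist_tube_base_subset: "dist_tube (- tube_base M) \<subseteq> M"
proof
  fix z assume z: "z \<in> dist_tube (- tube_base M)"
  have "(re_vec z, norm (im_vec z)) \<in> tube_base M"
  proof (rule ccontr)
    assume "(re_vec z, norm (im_vec z)) \<notin> tube_base M"
    then have "infdist (re_vec z, 0) (- tube_base M) \<le> dist (re_vec z, 0) (re_vec z, norm (im_vec z))"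
      by (intro infdist_le) simp
    with z show False
      by (simp add: dist_tube_def dist_Pair_Pair)
  qed
  then show "z \<in> M" by (auto simp: tube_base_def)
qed

lemma real_vec_in_dist_tube_base:
  assumes "real_vec x \<in> interior M" "- tube_base M \<noteq> {}"
  shows "real_vec x \<in> dist_tube (- tube_base M)"
proof -
  obtain e where e: "e > 0" "ball (real_vec x) e \<subseteq> M"
    using assms(1) unfolding mem_interior by blast
  have "e / 2 \<le> dist (x, 0) p" if p: "p \<in> - tube_base M" for p
  proof -
    obtain b s z where b: "p = (b, s)" "re_vec z = b" "norm (im_vec z) \<le> \<bar>s\<bar>" "z \<notin> M"
      using p by (auto simp: tube_base_def)
    have "e \<le> norm (z - real_vec x)"
      using b(4) e(2) by (auto simp: dist_norm norm_minus_commute not_less[symmetric])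
    also have "\<dots> \<le> norm (b - x) + norm (im_vec z)"
      using norm_le_re_im[of "z - real_vec x"] b(2) by simp
    also have "\<dots> \<le> dist (x, 0) p + dist (x, 0) p"
      using dist_fst_le[of "(x, 0)" p] dist_snd_le[of "(x, 0)" p] b(1,3)
      by (intro add_mono) (auto simp: dist_norm norm_minus_commute)
    finally show ?thesis by simp
  qed
  then have "e / 2 \<le> infdist (x, 0) (- tube_base M)"
    unfolding infdist_notempty[OF assms(2)] using assms(2) by (intro cINF_greatest) auto
  then show ?thesis
    using e(1) by (simp add: dist_tube_def)
qed

lemma infdist_tube_base_scaleR:
  assumes M: "\<And>z t. z \<in> M \<Longrightarrow> t \<ge> 1 \<Longrightarrow> t *\<^sub>R z \<in> M" and "- tube_base M \<noteq> {}" "t \<ge> 1"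
  shows "t * infdist p (- tube_base M) \<le> infdist (t *\<^sub>R p) (- tube_base M)"
proof (rule infdist_scaleR_ge)
  fix p assume "p \<in> - tube_base M"
  then obtain b s z where b: "p = (b, s)" "re_vec z = b" "norm (im_vec z) \<le> \<bar>s\<bar>" "z \<notin> M"
    by (auto simp: tube_base_def)
  have "z /\<^sub>R t \<notin> M"
    using M[of "z /\<^sub>R t" t] b(4) assms(3) by auto
  moreover have "norm (im_vec (z /\<^sub>R t)) \<le> \<bar>s / t\<bar>"
    using b(3) assms(3) by (simp add: divide_simps abs_mult)
  ultimately have "(b /\<^sub>R t, s / t) \<notin> tube_base M"
    using b(2) unfolding tube_base_def by fastforce
  then show "p /\<^sub>R t \<in> - tube_base M"
    using b(1) by (simp add: divide_inverse mult.commute)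
qed (use assms in auto)

text \<open>
  If an open set is stable under dilations by \<open>t \<ge> 1\<close> far from the origin, then adding the directions
  that it meets far out gives a set regular at infinity: outside the ball of radius \<open>R\<close>, a ray
  either meets \<open>W\<close>, and then \<open>W\<close> contains a conic neighbourhood of its end, or avoids \<open>W\<close>.
\<close>

lemma regular_at_inf_far_cone:
  fixes W :: "'a::real_normed_vector set"
  assumes "open W" "R \<ge> 0"
    and scale: "\<And>z t. z \<in> W \<Longrightarrow> norm z > R \<Longrightarrow> t \<ge> 1 \<Longrightarrow> t *\<^sub>R z \<in> W"
  defines "U \<equiv> Fin ` W \<union> Dir ` {\<zeta>. norm \<zeta> = 1 \<and> (\<exists>s>R. s *\<^sub>R \<zeta> \<in> W)}"
  shows "regular_at_inf U"
proof -
  have open_U: "openin radial_top U"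
    unfolding openin_radial_top radial_open_def
  proof (intro conjI allI impI)
    show "U \<subseteq> radial_points"
      by (auto simp: U_def radial_points_def sphere_inf_def)
  next
    fix z assume "Fin z \<in> U"
    then have "z \<in> W" by (auto simp: U_def)
    then obtain e where "e > 0" "ball z e \<subseteq> W"
      using \<open>open W\<close> unfolding open_contains_ball by blast
    then show "\<exists>e>0. Fin ` ball z e \<subseteq> U"
      unfolding U_def by blast
  next
    fix \<zeta> assume "Dir \<zeta> \<in> U"
    then obtain s where s: "norm \<zeta> = 1" "s > R" "s *\<^sub>R \<zeta> \<in> W" by (auto simp: U_def)
    let ?\<Gamma> = "sphere 0 1 \<inter> (\<lambda>\<xi>. s *\<^sub>R \<xi>) -` W"
    have "openin (top_of_set (sphere 0 1)) ?\<Gamma>"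
      using \<open>open W\<close> by (intro openin_open_Int open_vimage continuous_intros)
    moreover have "cone_nhd s ?\<Gamma> \<subseteq> U"
    proof -
      have "z \<in> W" if z: "norm z > s" "s *\<^sub>R (z /\<^sub>R norm z) \<in> W" for z
      proof -
        have "s > 0" "z \<noteq> 0" using z(1) s(2) \<open>R \<ge> 0\<close> by auto
        then have "norm (s *\<^sub>R (z /\<^sub>R norm z)) > R" "norm z / s \<ge> 1"
          using z(1) s(2) by (simp_all add: divide_simps)
        then have "(norm z / s) *\<^sub>R (s *\<^sub>R (z /\<^sub>R norm z)) \<in> W"
          by (rule scale[OF z(2)])
        then show ?thesis
          using \<open>s > 0\<close> \<open>z \<noteq> 0\<close> by simp
      qed
      then show ?thesis
        using s(2) by (auto simp: cone_nhd_def U_def)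
    qed
    ultimately show "\<exists>r>0. \<exists>\<Gamma>. openin (top_of_set (sphere 0 1)) \<Gamma> \<and> \<zeta> \<in> \<Gamma> \<and> cone_nhd r \<Gamma> \<subseteq> U"
      using s \<open>R \<ge> 0\<close> by (intro exI[of _ s] conjI exI[of _ ?\<Gamma>]) auto
  qed
  have "Dir \<zeta> \<in> clos1_inf (range Fin - U) \<longleftrightarrow> Dir \<zeta> \<notin> U" if \<zeta>: "norm \<zeta> = 1" for \<zeta>
  proof
    assume "Dir \<zeta> \<in> clos1_inf (range Fin - U)"
    then obtain z where z: "\<And>k. Fin (z k) \<notin> U"
        "limitin radial_top (\<lambda>k. Fin (z k)) (Dir \<zeta>) sequentially"
      unfolding clos1_inf_def by blast
    then show "Dir \<zeta> \<notin> U"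
      using open_U unfolding limitin_def eventually_sequentially by blast
  next
    assume "Dir \<zeta> \<notin> U"
    let ?z = "\<lambda>k. (real k + (R + 1)) *\<^sub>R \<zeta>"
    have "Fin (?z k) \<in> range Fin - U" for k
    proof -
      have "real k + (R + 1) > R" by simp
      then have "?z k \<notin> W"
        using \<open>Dir \<zeta> \<notin> U\<close> \<zeta> unfolding U_def by blast
      then show ?thesis by (auto simp: U_def)
    qed
    moreover have "limitin radial_top (\<lambda>k. Fin (?z k)) (Dir \<zeta>) sequentially"
      by (rule limitin_ray[OF \<zeta>])
    moreover have "(\<lambda>k. norm (?z (Suc k)) / norm (?z k)) \<longlonglongrightarrow> 1"
      using \<open>R \<ge> 0\<close> by (intro ray_ratio_tendsto_1 \<zeta>) simp
    moreover have "Dir \<zeta> \<in> sphere_inf"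
      using \<zeta> by (simp add: sphere_inf_def)
    ultimately show "Dir \<zeta> \<in> clos1_inf (range Fin - U)"
      unfolding clos1_inf_def by (intro CollectI conjI exI[of _ ?z]) blast+
  qed
  then have "N1_inf U = U \<inter> sphere_inf"
    unfolding N1_inf_def sphere_inf_def by auto
  with open_U show ?thesis
    unfolding regular_at_inf_def by blast
qed

theorem theorem4p9:
  fixes \<Omega> :: "(real ^ 'n::finite) set" and V :: "(complex ^ 'n) radial set"
  assumes "open \<Omega>" and "Rplus_conic \<Omega>"
    and "openin radial_top V" and "real_incl ` radial_hat \<Omega> \<subseteq> V"
  shows "\<exists>U :: (complex ^ 'n) radial set. openin radial_top U
           \<and> real_incl ` radial_hat \<Omega> \<subseteq> U \<and> U \<subseteq> V
           \<and> regular_at_inf U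
           \<and> stein_open (Fin -` U)"
proof -
  have hat: "radial_hat \<Omega> = Fin ` \<Omega> \<union> Dir ` (\<Omega> \<inter> sphere 0 1)"
    using assms(1,2) by (rule radial_hat_conic)
  have conic: "t *\<^sub>R x \<in> \<Omega>" if "x \<in> \<Omega>" "t > 0" for t x
    using assms(2) that by (simp add: Rplus_conic_def)
  have V_Fin: "Fin (real_vec x) \<in> V" if "x \<in> \<Omega>" for x
    using assms(4) that by (force simp: hat simp flip: real_incl_Fin)
  have V_Dir: "Dir (real_vec x) \<in> V" if "x \<in> \<Omega>" "norm x = 1" for x
    using assms(4) that by (force simp: hat simp flip: real_incl_Dir)
  obtain \<delta> where \<delta>: "\<delta> \<ge> 0" "Fin ` ball 0 \<delta> \<subseteq> V" "0 \<in> \<Omega> \<Longrightarrow> \<delta> > 0"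
  proof (cases "0 \<in> \<Omega>")
    case True
    then have "0 \<in> Fin -` V" using V_Fin[of 0] by simp
    then obtain e where "e > 0" "ball 0 e \<subseteq> Fin -` V"
      using open_Fin_vimage[OF assms(3)] unfolding open_contains_ball by blast
    then show ?thesis by (intro that[of e]) auto
  qed (use that[of 0] in auto)
  define T where "T = ray_core V \<inter> {w. 2 * norm (im_vec w) < norm (re_vec w)}"
  define M where "M = T \<union> ball 0 \<delta>"
  define W where "W = dist_tube (- tube_base M)"
  have T_scale: "t *\<^sub>R w \<in> T" if "w \<in> T" "t \<ge> 1" for t w
    using that by (auto simp: T_def ray_core_scaleR)
  have T_real: "real_vec x \<in> interior T" if "x \<in> \<Omega>" "x \<noteq> 0" for x
  proof -
    have "x /\<^sub>R norm x \<in> \<Omega>" "norm (x /\<^sub>R norm x) = 1"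
      using that conic[of x "inverse (norm x)"] by auto
    then have "real_vec x \<in> ray_core V"
      using V_Fin conic V_Dir[of "x /\<^sub>R norm x"] that norm_real_vec[of x]
      by (auto simp: ray_core_def simp flip: real_vec_simps(5))
    then have "real_vec x \<in> interior (ray_core V)"
      by (rule in_interior_ray_core[OF assms(3)])
    moreover have "open {w :: complex ^ 'n. 2 * norm (im_vec w) < norm (re_vec w)}"
      by (intro open_Collect_less continuous_intros)
    ultimately show ?thesis
      using that by (simp add: T_def interior_open)
  qed
  have M_V: "Fin ` M \<subseteq> V"
  proof -
    have "Fin w \<in> V" if "w \<in> ray_core V" for w
      using that unfolding ray_core_def by (metis (lifting) mem_Collect_eq order_refl scaleR_one)
    then show ?thesis using \<delta>(2) by (auto simp: M_def T_def)
  qed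
  \<comment> \<open>A purely imaginary vector of norm \<open>\<delta>\<close> lies neither in \<open>T\<close> nor in the open ball.\<close>
  have "- tube_base M \<noteq> {}"
  proof -
    obtain y :: "real ^ 'n" where "norm y = \<delta>"
      using vector_choose_size[OF \<delta>(1)] by blast
    then obtain z :: "complex ^ 'n" where z: "re_vec z = 0" "norm (im_vec z) = \<delta>"
      using exists_im_vec[of y] by auto
    then have "norm z = \<delta>"
      using power2_norm_re_im[of z] \<delta>(1) by simp
    with z have "(0, \<delta>) \<notin> tube_base M"
      using \<delta>(1) by (force simp: tube_base_def M_def T_def)
    then show ?thesis by auto
  qed
  have base_mono: "tube_base T \<subseteq> tube_base M"
    unfolding tube_base_def M_def by blast
  have W_M: "W \<subseteq> M"
    unfolding W_def by (rule dist_tube_base_subset)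
  have W_far: "z \<in> T" if z: "z \<in> W" "norm z > 3 * \<delta>" for z
    using W_M z \<delta>(1) by (auto simp: M_def)
  have W_scale: "t *\<^sub>R z \<in> W" if z: "z \<in> W" "norm z > 3 * \<delta>" and "t \<ge> 1" for z t
  proof -
    let ?x = "re_vec z"
    have y: "2 * norm (im_vec z) < norm ?x"
      using W_far[OF z] by (simp add: T_def)
    then have x: "norm ?x > 2 * \<delta>"
      using norm_le_re_im[of z] z(2) by linarith
    \<comment> \<open>Only \<open>T\<close> is stable under dilations, so the bound on \<open>norm (im_vec z)\<close> is first moved from
      the base of \<open>M\<close> to that of \<open>T\<close>: the points that only the base of \<open>M\<close> contains
      have first component of norm less than \<open>\<delta>\<close>, hence are too far from \<open>(?x, 0)\<close> to matter.\<close>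
    let ?m = "min (infdist (?x, 0) (- tube_base M)) (norm ?x - \<delta>)"
    have "?m \<le> dist (?x, 0) p" if p: "p \<in> - tube_base T" for p
    proof (cases "p \<in> tube_base M")
      case True
      obtain b s w where b: "p = (b, s)" "re_vec w = b" "norm (im_vec w) \<le> \<bar>s\<bar>" "w \<notin> T"
        using p by (auto simp: tube_base_def)
      with True have "w \<in> ball 0 \<delta>"
        by (auto simp: tube_base_def M_def)
      moreover have "norm b \<le> norm w"
        using norm_re_vec_le[of w] b(2) by simp
      ultimately have "norm ?x - \<delta> \<le> norm (?x - b)"
        using norm_triangle_ineq2[of ?x b] by simp
      then show ?thesis
        using dist_fst_le[of "(?x, 0)" p] b(1) by (simp add: dist_norm)
    qed (simp add: infdist_le min.coboundedI1)
    then have "?m \<le> infdist (?x, 0) (- tube_base T)"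
      using \<open>- tube_base M \<noteq> {}\<close> base_mono
      by (subst infdist_notempty) (auto intro!: cINF_greatest)
    moreover have "norm (im_vec z) < ?m"
      using z(1) x y by (simp add: W_def dist_tube_def)
    ultimately have "norm (im_vec z) < infdist (?x, 0) (- tube_base T)"
      by (rule less_le_trans[rotated])
    then have "t * norm (im_vec z) < t * infdist (?x, 0) (- tube_base T)"
      using \<open>t \<ge> 1\<close> by simp
    also have "\<dots> \<le> infdist (t *\<^sub>R (?x, 0)) (- tube_base T)"
      using \<open>- tube_base M \<noteq> {}\<close> base_mono \<open>t \<ge> 1\<close> T_scale
      by (intro infdist_tube_base_scaleR) auto
    also have "\<dots> \<le> infdist (t *\<^sub>R (?x, 0)) (- tube_base M)"
      using \<open>- tube_base M \<noteq> {}\<close> base_mono by (intro infdist_mono) auto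
    finally show ?thesis
      using \<open>t \<ge> 1\<close> by (simp add: W_def dist_tube_def)
  qed
  have W_real: "real_vec x \<in> W" if "x \<in> \<Omega>" for x
  proof -
    have "real_vec x \<in> interior M"
    proof (cases "x = 0")
      case True
      then have "real_vec x \<in> ball 0 \<delta>"
        using \<delta>(3) that by simp
      moreover have "ball 0 \<delta> \<subseteq> interior M"
        by (simp add: M_def interior_maximal)
      ultimately show ?thesis by blast
    next
      case False
      moreover have "interior T \<subseteq> interior M"
        by (simp add: M_def interior_mono)
      ultimately show ?thesis using T_real that by blast
    qed
    then show ?thesis
      unfolding W_def using \<open>- tube_base M \<noteq> {}\<close> by (rule real_vec_in_dist_tube_base)
  qed
  define U where "U = Fin ` W \<union> Dir ` {\<zeta>. norm \<zeta> = 1 \<and> (\<exists>s>3 * \<delta>. s *\<^sub>R \<zeta> \<in> W)}"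
  have reg: "regular_at_inf U"
    unfolding U_def using \<delta>(1) W_scale
    by (intro regular_at_inf_far_cone) (auto simp: W_def open_dist_tube)
  have "real_incl ` radial_hat \<Omega> \<subseteq> U"
  proof -
    have "(3 * \<delta> + 1) *\<^sub>R real_vec x \<in> W" if "x \<in> \<Omega>" for x
      using W_real[OF conic[OF that, of "3 * \<delta> + 1"]] \<delta>(1) by simp
    then have "\<exists>s>3 * \<delta>. s *\<^sub>R real_vec x \<in> W" if "x \<in> \<Omega>" for x
      using that by (intro exI[of _ "3 * \<delta> + 1"]) simp
    then show ?thesis
      using W_real by (auto simp: hat real_incl_Fin real_incl_Dir U_def)
  qed
  moreover have "U \<subseteq> V"
  proof -
    have "Dir \<zeta> \<in> V" if \<zeta>: "norm \<zeta> = 1" "s > 3 * \<delta>" "s *\<^sub>R \<zeta> \<in> W" for \<zeta> s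
    proof -
      have "s > 0" using \<zeta>(2) \<delta>(1) by linarith
      then have "s *\<^sub>R \<zeta> \<in> ray_core V"
        using W_far[OF \<zeta>(3)] \<zeta>(1,2) by (simp add: T_def)
      then show ?thesis
        using \<zeta>(1) \<open>s > 0\<close> by (simp add: ray_core_def)
    qed
    then show ?thesis
      using W_M M_V unfolding U_def by blast
  qed
  moreover have "Fin -` U = W"
    by (auto simp: U_def)
  then have "stein_open (Fin -` U)"
    using stein_open_dist_tube[OF \<open>- tube_base M \<noteq> {}\<close>] by (simp add: W_def)
  ultimately show ?thesis
    using reg unfolding regular_at_inf_def by blast
qed

end
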